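(* Let $\Gamma$ be a finite abelian group and let $S\subseteq\Gamma$ with $0\notin S$. If $S\in\mathbb{E}(\Gamma)$, then the oriented Cayley graph $\mathrm{Cay}(\Gamma,S)$ is HS-integral.
   Context: $\Gamma$ is written additively; $x^k$ denotes $kx$. A set $S$ is skew-symmetric if $-a\notin S$ for all $a\in S$. $\mathrm{Cay}(\Gamma,S)$ has vertex set $\Gamma$ and arcs $(a,b)$ with $b-a\in S$. Its Hermitian adjacency matrix of second kind $\mathcal{H}=(h_{uv})$ has $h_{uv}=1$ if both $(u,v)$ and $(v,u)$ are arcs, $h_{uv}=\frac{1+i\sqrt3}{2}$ if only $(u,v)$ is an arc, $h_{uv}=\frac{1-i\sqrt3}{2}$ if only $(v,u)$ is an arc, and $h_{uv}=0$ otherwise. The graph is HS-integral if all eigenvalues of $\mathcal{H}$ are integers. $\Gamma(3)$ is the set of elements of $\Gamma$ whose order is divisible by $3$. For $x\in\Gamma(3)$ with $\mathrm{ord}(x)=m$, put $\langle\!\langle x\rangle\!\rangle=\{x^k:1\le k\le m-1,\ \gcd(k,m)=1,\ k\equiv 1\pmod 3\}$. If $\Gamma(3)\ne\emptyset$, $\mathbb{E}(\Gamma)$ is the set of skew-symmetric subsets of the form $\langle\!\langle x_1\rangle\!\rangle\cup\cdots\cup\langle\!\langle x_k\rangle\!\rangle$ with $x_i\in\Gamma(3)$. If $\Gamma(3)=\emptyset$, then $\mathbb{E}(\Gamma)=\{\emptyset\}$. *)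

theory Defs
  imports
    Complex_Main
    "HOL-Algebra.Multiplicative_Group"
    "HOL-Number_Theory.Cong"
    "Graph_Theory.Pair_Digraph"
    "Jordan_Normal_Form.Char_Poly"
begin

text \<open>
  The abelian group is a \<^locale>\<open>comm_group\<close> record, hence multiplicative:
  \<open>\<one>\<close> is the element 0, \<open>inv a\<close> is \<open>-a\<close>, \<open>b \<otimes> inv a\<close> is \<open>b - a\<close>, and \<open>x [^] k\<close> is \<open>kx\<close>.
\<close>

definition skew_symmetric :: "('a, 'm) monoid_scheme \<Rightarrow> 'a set \<Rightarrow> bool" where
  "skew_symmetric G S \<longleftrightarrow> (\<forall>a\<in>S. inv\<^bsub>G\<^esub> a \<notin> S)"

definition Cay :: "('a, 'm) monoid_scheme \<Rightarrow> 'a set \<Rightarrow> 'a pair_pre_digraph" where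
  "Cay G S = \<lparr> pverts = carrier G,
     parcs = {(a, b). a \<in> carrier G \<and> b \<in> carrier G \<and> b \<otimes>\<^bsub>G\<^esub> inv\<^bsub>G\<^esub> a \<in> S} \<rparr>"

definition hermitian_entry :: "'a pair_pre_digraph \<Rightarrow> 'a \<Rightarrow> 'a \<Rightarrow> complex" where
  "hermitian_entry D u v =
     (if (u, v) \<in> parcs D \<and> (v, u) \<in> parcs D then 1
      else if (u, v) \<in> parcs D then (1 + \<i> * complex_of_real (sqrt 3)) / 2
      else if (v, u) \<in> parcs D then (1 - \<i> * complex_of_real (sqrt 3)) / 2
      else 0)"

text \<open>The rows and columns are ordered by a list \<open>vs\<close> that enumerates the vertices.\<close>

definition hermitian_adjacency :: "'a pair_pre_digraph \<Rightarrow> 'a list \<Rightarrow> complex mat" where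
  "hermitian_adjacency D vs =
     mat (length vs) (length vs) (\<lambda>(i, j). hermitian_entry D (vs ! i) (vs ! j))"

text \<open>
  Enumerations give permutation-similar matrices, so the choice is immaterial; the finiteness
  conjunct guarantees that one exists.
\<close>

definition HS_integral :: "'a pair_pre_digraph \<Rightarrow> bool" where
  "HS_integral D \<longleftrightarrow> finite (pverts D) \<and>
     (\<forall>vs. distinct vs \<and> set vs = pverts D \<longrightarrow>
        (\<forall>c. eigenvalue (hermitian_adjacency D vs) c \<longrightarrow> c \<in> \<int>))"

text \<open>
  For finite groups only: \<^const>\<open>group.ord\<close> is 0, hence divisible by 3, on elements of infinite order.
\<close>

definition Gamma3 :: "('a, 'm) monoid_scheme \<Rightarrow> 'a set" where
  "Gamma3 G = {x \<in> carrier G. 3 dvd group.ord G x}"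

definition ang :: "('a, 'm) monoid_scheme \<Rightarrow> 'a \<Rightarrow> 'a set" where
  "ang G x = {x [^]\<^bsub>G\<^esub> k | k :: nat.
     1 \<le> k \<and> k \<le> group.ord G x - 1 \<and> gcd k (group.ord G x) = 1 \<and> [k = 1] (mod 3)}"

text \<open>The empty union (no generators) is admitted.\<close>

definition EE :: "('a, 'm) monoid_scheme \<Rightarrow> 'a set set" where
  "EE G = (if Gamma3 G \<noteq> {}
     then {S. skew_symmetric G S \<and> (\<exists>X. finite X \<and> X \<subseteq> Gamma3 G \<and> S = (\<Union>x\<in>X. ang G x))}
     else {{}})"

end

theory Submission
  imports Defs "HOL-Number_Theory.Totient"
begin

text \<open>
  The Hermitian adjacency matrix of a Cayley graph of an abelian group is a convolution operator, so
  each eigenspace is invariant under the commuting translations and contains a common eigenvector of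
  them. Every eigenvalue is therefore a weighted sum of a character over \<open>S\<close>. The sets \<open>ang G x\<close>
  partition \<open>S\<close>, and since the weights are, up to sign, the two primitive cube roots of unity, the sum
  over one of them is the negative of a Ramanujan sum. Ramanujan sums are integers because the full
  sum of the powers of a root of unity, which is an integer, splits into Ramanujan sums by gcd.
\<close>

section \<open>Sums over roots of unity\<close>

text \<open>Strong induction on \<open>n\<close>: each class of exponents with gcd
  \<open>d > 1\<close> gives a sum of the same kind for \<open>n div d\<close> and
  \<open>z ^ d\<close>. The root \<open>z\<close> is any n-th root of unity, because it will be
  \<open>\<tau> * \<chi> x\<close>, whose order may be smaller than \<open>ord x\<close>.\<close>

lemma sum_powers_totatives_Ints:
  fixes z :: complex
  assumes "z ^ n = 1"
  shows "(\<Sum>k\<in>totatives n. z ^ k) \<in> \<int>"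
  using assms
proof (induction n arbitrary: z rule: less_induct)
  case (less n)
  show ?case
  proof (cases "n = 0")
    case False
    then have n: "n > 0" by simp
    define R where "R d = (\<Sum>k\<in>totatives (n div d). (z ^ d) ^ k)" for d
    have R_Ints: "R d \<in> \<int>" if "d dvd n" "d \<noteq> 1" for d
      unfolding R_def
    proof (rule less.IH)
      show "n div d < n" using that n dvd_pos_nat [OF n that(1)] by (intro div_less_dividend) auto
      show "(z ^ d) ^ (n div d) = 1"
        using that less.prems by (simp flip: power_mult)
    qed
    have "(\<Sum>k\<in>{0<..n}. z ^ k) = (\<Sum>d | d dvd n. \<Sum>k | k \<in> {0<..n} \<and> gcd k n = d. z ^ k)"
      by (rule sum.group [symmetric]) (use n in auto)
    also have "\<dots> = (\<Sum>d | d dvd n. R d)"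
    proof (intro sum.cong refl)
      fix d assume "d \<in> {d. d dvd n}"
      then have d: "d dvd n" by simp
      show "(\<Sum>k | k \<in> {0<..n} \<and> gcd k n = d. z ^ k) = R d"
        unfolding R_def
        \<comment> \<open>Multiplication by \<open>d\<close> maps the totatives of
          \<open>n div d\<close> bijectively onto the exponents in \<open>{0<..n}\<close> whose gcd
          with \<open>n\<close> is \<open>d\<close>.\<close>
        by (subst sum.reindex_bij_betw [OF bij_betw_totatives_gcd_eq [OF d n], symmetric])
           (simp add: mult.commute flip: power_mult)
    qed
    also have "\<dots> = R 1 + (\<Sum>d\<in>{d. d dvd n} - {1}. R d)"
      by (rule sum.remove) (use n in auto)
    finally have eq: "R 1 = (\<Sum>k\<in>{0<..n}. z ^ k) - (\<Sum>d\<in>{d. d dvd n} - {1}. R d)"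
      by simp
    have "(\<Sum>k\<in>{0<..n}. z ^ k) \<in> \<int>"
    proof (cases "z = 1")
      case False
      have "(\<Sum>k\<in>{0<..n}. z ^ k) = (\<Sum>k<n. z ^ Suc k)"
        by (rule sum.reindex_bij_witness [of _ Suc "\<lambda>k. k - 1"]) auto
      also have "\<dots> = z * (\<Sum>k<n. z ^ k)" by (simp add: sum_distrib_left)
      also have "\<dots> = 0" using False less.prems by (simp add: geometric_sum)
      finally show ?thesis by simp
    qed simp
    then have "R 1 \<in> \<int>"
      unfolding eq by (rule Ints_diff [OF _ Ints_sum]) (auto intro: R_Ints)
    then show ?thesis by (simp add: R_def)
  qed simp
qed

text \<open>A nonzero polynomial of degree below \<open>n\<close> has fewer than \<open>n\<close>
  roots, while there are \<open>n\<close> complex n-th roots of unity. This will guarantee that some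
  projection of an eigenfunction is nonzero.\<close>

lemma polyfun_zero_on_roots_unity:
  fixes a :: "nat \<Rightarrow> complex"
  assumes "n > 0" and zero: "\<And>z. z ^ n = 1 \<Longrightarrow> (\<Sum>k<n. a k * z ^ k) = 0" and "k < n"
  shows "a k = 0"
proof (rule ccontr)
  assume "a k \<noteq> 0"
  define Z where "Z = {z. (\<Sum>i\<le>n - 1. a i * z ^ i) = 0}"
  have "k \<le> n - 1" using \<open>k < n\<close> by simp
  then have Z: "finite Z" "card Z \<le> n - 1"
    unfolding Z_def using \<open>a k \<noteq> 0\<close> polyfun_rootbound [of a k "n - 1"] by auto
  have "{..n - 1} = {..<n}" using \<open>n > 0\<close> by auto
  then have "{z. z ^ n = 1} \<subseteq> Z" unfolding Z_def using zero by auto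
  then have "n \<le> card Z"
    using card_mono [OF Z(1)] card_roots_unity_eq [OF \<open>n > 0\<close>] by metis
  then show False using Z \<open>n > 0\<close> by linarith
qed

section \<open>Characters from eigenfunctions of a convolution\<close>

context comm_group
begin

text \<open>Translations commute with each other and with the convolution, so projecting onto an
  eigenspace of one more translation keeps the eigenvalue \<open>c\<close> and the translation
  eigenvalues already secured. Induction on \<open>A\<close> does this one element at a
  time.\<close>

lemma translation_eigenvector:
  fixes f :: "'a \<Rightarrow> complex" and \<phi> :: "'a \<Rightarrow> complex"
  assumes fin: "finite (carrier G)"
    and nz: "\<exists>u\<in>carrier G. f u \<noteq> 0"
    and eig: "\<And>u. u \<in> carrier G \<Longrightarrow> (\<Sum>g\<in>carrier G. \<phi> g * f (g \<otimes> u)) = c * f u"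
    and "finite A" "A \<subseteq> carrier G"
  shows "\<exists>h. (\<exists>u\<in>carrier G. h u \<noteq> 0) \<and>
    (\<forall>u\<in>carrier G. (\<Sum>g\<in>carrier G. \<phi> g * h (g \<otimes> u)) = c * h u) \<and>
    (\<forall>a\<in>A. \<exists>l. \<forall>u\<in>carrier G. h (a \<otimes> u) = l * h u)"
  using assms(4,5)
proof (induction A rule: finite_induct)
  case empty
  show ?case using nz eig by blast
next
  case (insert b A)
  obtain h where h: "\<exists>u\<in>carrier G. h u \<noteq> 0"
    and h_eig: "\<And>u. u \<in> carrier G \<Longrightarrow> (\<Sum>g\<in>carrier G. \<phi> g * h (g \<otimes> u)) = c * h u"
    and h_tr: "\<And>a. a \<in> A \<Longrightarrow> \<exists>l. \<forall>u\<in>carrier G. h (a \<otimes> u) = l * h u"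
    using insert.IH insert.prems by blast
  from insert.prems have b: "b \<in> carrier G" and A: "A \<subseteq> carrier G" by auto
  define n where "n = ord b"
  have n: "n > 0" unfolding n_def using ord_ge_1 [OF fin b] by simp
  obtain u0 where u0: "u0 \<in> carrier G" "h u0 \<noteq> 0" using h by blast
  \<comment> \<open>If the sum vanished at every n-th root of unity, all its coefficients in
    \<open>z\<close> would be zero, yet the constant one is \<open>h u0\<close>.\<close>
  have "\<exists>z. z ^ n = 1 \<and> (\<Sum>k<n. h (b [^] k \<otimes> u0) * z ^ k) \<noteq> 0"
  proof (rule ccontr)
    assume "\<not> ?thesis"
    then have "h (b [^] (0::nat) \<otimes> u0) = 0"
      by (intro polyfun_zero_on_roots_unity [where a = "\<lambda>k. h (b [^] k \<otimes> u0)"]) (use n in auto)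
    then show False using u0 by simp
  qed
  then obtain z where z: "z ^ n = 1" and znz: "(\<Sum>k<n. h (b [^] k \<otimes> u0) * z ^ k) \<noteq> 0"
    by blast
  \<comment> \<open>Up to the factor \<open>n\<close>, this is the projection of \<open>h\<close>
    onto the eigenspace of translation by \<open>b\<close> with eigenvalue
    \<open>inverse z\<close>.\<close>
  define h' where "h' u = (\<Sum>k<n. h (b [^] k \<otimes> u) * z ^ k)" for u
  have z0: "z \<noteq> 0" using z n by (metis zero_neq_one power_0_left less_numeral_extra(3))
  have 1: "(\<Sum>g\<in>carrier G. \<phi> g * h' (g \<otimes> u)) = c * h' u" if u: "u \<in> carrier G" for u
  proof -
    have "(\<Sum>g\<in>carrier G. \<phi> g * h' (g \<otimes> u)) =
        (\<Sum>k<n. \<Sum>g\<in>carrier G. \<phi> g * h (b [^] k \<otimes> (g \<otimes> u)) * z ^ k)"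
      unfolding h'_def sum_distrib_left by (subst sum.swap) (simp add: mult.assoc)
    also have "\<dots> = (\<Sum>k<n. (\<Sum>g\<in>carrier G. \<phi> g * h (g \<otimes> (b [^] k \<otimes> u))) * z ^ k)"
      unfolding sum_distrib_right using b u by (intro sum.cong refl) (simp add: m_lcomm)
    also have "\<dots> = (\<Sum>k<n. (c * h (b [^] k \<otimes> u)) * z ^ k)"
      using b u by (simp add: h_eig)
    also have "\<dots> = c * h' u" by (simp add: h'_def sum_distrib_left mult.assoc)
    finally show ?thesis .
  qed
  have 2: "\<exists>l. \<forall>u\<in>carrier G. h' (a \<otimes> u) = l * h' u" if a: "a \<in> A" for a
  proof -
    obtain l where l: "\<And>u. u \<in> carrier G \<Longrightarrow> h (a \<otimes> u) = l * h u" using h_tr a by blast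
    have "h' (a \<otimes> u) = l * h' u" if u: "u \<in> carrier G" for u
    proof -
      have "h (b [^] k \<otimes> (a \<otimes> u)) = l * h (b [^] k \<otimes> u)" for k :: nat
        using l [of "b [^] k \<otimes> u"] a A b u by (simp add: m_lcomm subsetD)
      then show ?thesis by (simp add: h'_def sum_distrib_left mult.assoc)
    qed
    then show ?thesis by blast
  qed
  have 3: "h' (b \<otimes> u) = inverse z * h' u" if u: "u \<in> carrier G" for u
  proof -
    define t where "t k = h (b [^] k \<otimes> u) * z ^ k" for k :: nat
    \<comment> \<open>Multiplying by \<open>z\<close> shifts the index by one; the sum does not
      change because \<open>t n = t 0\<close>.\<close>
    have "z * h' (b \<otimes> u) = (\<Sum>k<n. t (Suc k))"
      unfolding h'_def t_def sum_distrib_left using b u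
      by (intro sum.cong refl) (simp add: m_assoc)
    also have "\<dots> = (\<Sum>k<n. t k) + t n - t 0"
      by (metis sum.lessThan_Suc sum.lessThan_Suc_shift add_diff_cancel_left')
    also have "t n = t 0" using b z unfolding t_def n_def by simp
    finally have "z * h' (b \<otimes> u) = h' u" by (simp add: h'_def t_def)
    then show ?thesis using z0 by (simp add: field_simps)
  qed
  have "h' u0 \<noteq> 0" using znz by (simp add: h'_def)
  then show ?case using u0(1) 1 2 3 by (intro exI [of _ h']) blast
qed

text \<open>The value at \<open>\<one>\<close> of a common eigenvector of all translations does not vanish, so it can be
  normalised to a character.\<close>
lemma convolution_eigenvalue_character:
  fixes f :: "'a \<Rightarrow> complex" and \<phi> :: "'a \<Rightarrow> complex"
  assumes fin: "finite (carrier G)"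
    and nz: "\<exists>u\<in>carrier G. f u \<noteq> 0"
    and eig: "\<And>u. u \<in> carrier G \<Longrightarrow> (\<Sum>g\<in>carrier G. \<phi> g * f (g \<otimes> u)) = c * f u"
  obtains \<chi> :: "'a \<Rightarrow> complex" where "\<chi> \<one> = 1"
    and "\<And>a b. a \<in> carrier G \<Longrightarrow> b \<in> carrier G \<Longrightarrow> \<chi> (a \<otimes> b) = \<chi> a * \<chi> b"
    and "c = (\<Sum>g\<in>carrier G. \<phi> g * \<chi> g)"
proof -
  obtain h where h: "\<exists>u\<in>carrier G. h u \<noteq> 0"
    and h_eig: "\<And>u. u \<in> carrier G \<Longrightarrow> (\<Sum>g\<in>carrier G. \<phi> g * h (g \<otimes> u)) = c * h u"
    and h_tr: "\<forall>a\<in>carrier G. \<exists>l. \<forall>u\<in>carrier G. h (a \<otimes> u) = l * h u"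
    using translation_eigenvector [OF fin nz eig fin subset_refl] by blast
  from h_tr obtain l where l: "\<And>a u. a \<in> carrier G \<Longrightarrow> u \<in> carrier G \<Longrightarrow> h (a \<otimes> u) = l a * h u"
    by metis
  \<comment> \<open>Translation by \<open>a\<close> is evaluated at \<open>\<one>\<close>, so
    \<open>h \<one> = 0\<close> would force \<open>h\<close> to vanish on the whole group.\<close>
  have la: "h a = l a * h \<one>" if "a \<in> carrier G" for a
    using l [OF that one_closed] that by simp
  have h1: "h \<one> \<noteq> 0" using h la by (metis mult_zero_right)
  define \<chi> where "\<chi> a = h a / h \<one>" for a
  show thesis
  proof
    show "\<chi> \<one> = 1" using h1 by (simp add: \<chi>_def)
    show "\<chi> (a \<otimes> b) = \<chi> a * \<chi> b" if "a \<in> carrier G" "b \<in> carrier G" for a b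
      using l [OF that] la [OF that(1)] h1 by (simp add: \<chi>_def)
    have "(\<Sum>g\<in>carrier G. \<phi> g * h g) = c * h \<one>"
      using h_eig [OF one_closed] by (simp cong: sum.cong)
    then show "c = (\<Sum>g\<in>carrier G. \<phi> g * \<chi> g)"
      using h1 by (simp add: \<chi>_def field_simps flip: sum_divide_distrib)
  qed
qed

section \<open>The sets \<open>ang G x\<close> and their character sums\<close>

lemma pow_mod_ord:
  assumes "x \<in> carrier G"
  shows "x [^] (k mod ord x) = x [^] (k :: nat)"
proof -
  have "x [^] k = x [^] (ord x * (k div ord x) + k mod ord x)" by simp
  also have "\<dots> = (x [^] ord x) [^] (k div ord x) \<otimes> x [^] (k mod ord x)"
    using assms by (simp only: nat_pow_mult nat_pow_pow nat_pow_closed)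
  finally show ?thesis using assms by simp
qed

text \<open>Reduction modulo \<open>ord x\<close> preserves coprimality and, as
  \<open>3 dvd ord x\<close>, also the residue mod 3. Once the bounds on \<open>k\<close> are gone,
  exponents can be multiplied freely.\<close>

lemma ang_eq:
  assumes fin: "finite (carrier G)" and x: "x \<in> Gamma3 G"
  shows "ang G x = {x [^] k | k :: nat. coprime k (ord x) \<and> [k = 1] (mod 3)}"
proof
  show "ang G x \<subseteq> {x [^] k | k :: nat. coprime k (ord x) \<and> [k = 1] (mod 3)}"
    by (auto simp: ang_def coprime_iff_gcd_eq_1)
  show "{x [^] k | k :: nat. coprime k (ord x) \<and> [k = 1] (mod 3)} \<subseteq> ang G x"
  proof clarify
    fix k :: nat assume k: "coprime k (ord x)" "[k = 1] (mod 3)"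
    have xc: "x \<in> carrier G" and 3: "3 dvd ord x" using x by (auto simp: Gamma3_def)
    have m: "ord x > 0" using ord_ge_1 [OF fin xc] by simp
    have m3: "ord x \<ge> 3" using 3 m by (simp add: dvd_imp_le)
    have "x [^] k = x [^] (k mod ord x)"
      using xc by (simp add: pow_mod_ord)
    moreover have cop: "coprime (k mod ord x) (ord x)" using k(1) m
      by (metis coprime_mod_left_iff not_gr_zero)
    moreover have "k mod ord x \<noteq> 0" using cop m3 by (intro notI) simp
    moreover have "[k mod ord x = 1] (mod 3)"
      using k(2) 3 by (simp add: cong_def mod_mod_cancel)
    moreover have "k mod ord x \<le> ord x - 1"
      using mod_less_divisor [OF m, of k] by linarith
    ultimately show "x [^] k \<in> ang G x"
      unfolding ang_def coprime_iff_gcd_eq_1 by (intro CollectI exI [of _ "k mod ord x"]) auto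
  qed
qed

text \<open>The exponents prime to \<open>ord x\<close> and congruent to 1 mod 3 form a subgroup of
  the units modulo \<open>ord x\<close>, and \<open>ang G x\<close> is the orbit of \<open>x\<close>
  under it. Hence two such sets are equal or disjoint.\<close>

lemma ang_absorb:
  assumes fin: "finite (carrier G)" and x: "x \<in> Gamma3 G" and y: "y \<in> ang G x"
  shows "ang G y = ang G x"
proof -
  have xc: "x \<in> carrier G" and 3: "3 dvd ord x" using x by (auto simp: Gamma3_def)
  obtain k :: nat where k: "y = x [^] k" "coprime k (ord x)" "[k = 1] (mod 3)"
    using y ang_eq [OF fin x] by auto
  have ordy: "ord y = ord x"
    using k xc by (cases "k = 0") (simp_all add: ord_pow_gen coprime_iff_gcd_eq_1 gcd.commute)
  have y3: "y \<in> Gamma3 G" using xc k 3 ordy by (auto simp: Gamma3_def)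
  \<comment> \<open>The inverse of \<open>k\<close> modulo \<open>ord x\<close>; it is again 1 mod 3
    because \<open>3 dvd ord x\<close>.\<close>
  obtain j where j: "[k * j = 1] (mod ord x)"
    using k(2) cong_solve_coprime_nat by auto
  have jc: "coprime j (ord x)"
    using j by (metis coprime_iff_invertible_nat mult.commute One_nat_def)
  have "[k * j = 1] (mod 3)" using j 3 cong_dvd_modulus_nat by blast
  then have j3: "[j = 1] (mod 3)"
    using k(3) by (metis cong_scalar_right cong_sym cong_trans mult_1)
  have "[k * j * i = i] (mod ord x)" for i
    using cong_scalar_right [OF j, of i] by simp
  then have xy: "x [^] i = y [^] (j * i)" for i :: nat
    unfolding k(1) cong_def using xc pow_mod_ord [OF xc] by (metis nat_pow_pow mult.assoc)
  have "ang G y \<subseteq> ang G x"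
    unfolding ang_eq [OF fin x] ang_eq [OF fin y3] ordy
  proof clarify
    fix i :: nat assume i: "coprime i (ord x)" "[i = 1] (mod 3)"
    have "y [^] i = x [^] (k * i)" using k xc by (simp add: nat_pow_pow)
    moreover have "[k * i = 1] (mod 3)" using cong_mult [OF k(3) i(2)] by simp
    ultimately show "\<exists>k'. y [^] i = x [^] k' \<and> coprime k' (ord x) \<and> [k' = 1] (mod 3)"
      using i(1) k(2) by auto
  qed
  moreover have "ang G x \<subseteq> ang G y"
    unfolding ang_eq [OF fin x] ang_eq [OF fin y3] ordy
  proof clarify
    fix i :: nat assume i: "coprime i (ord x)" "[i = 1] (mod 3)"
    have "[j * i = 1] (mod 3)" using cong_mult [OF j3 i(2)] by simp
    then show "\<exists>k'. x [^] i = y [^] k' \<and> coprime k' (ord x) \<and> [k' = 1] (mod 3)"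
      using i(1) jc xy [of i] by auto
  qed
  ultimately show ?thesis by blast
qed

text \<open>The weight \<open>(1 + \<i> \<surd>3) / 2\<close> is \<open>- \<tau>\<close> for a primitive cube root of unity \<open>\<tau>\<close>, and its conjugate
  is \<open>- \<tau>\<^sup>2\<close>; hence the sum is \<open>- (\<Sum>k. (\<tau> \<chi>(x))\<^sup>k)\<close> over all residues \<open>k\<close> prime to \<open>ord x\<close>.\<close>
lemma ang_character_sum_Ints:
  fixes \<chi> :: "'a \<Rightarrow> complex"
  assumes fin: "finite (carrier G)" and x: "x \<in> Gamma3 G"
    and \<chi>1: "\<chi> \<one> = 1"
    and \<chi>m: "\<And>a b. a \<in> carrier G \<Longrightarrow> b \<in> carrier G \<Longrightarrow> \<chi> (a \<otimes> b) = \<chi> a * \<chi> b"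
  shows "(\<Sum>s\<in>ang G x. (1 + \<i> * complex_of_real (sqrt 3)) / 2 * \<chi> s
           + (1 - \<i> * complex_of_real (sqrt 3)) / 2 * \<chi> (inv s)) \<in> \<int>"
proof -
  define w where "w = (1 + \<i> * complex_of_real (sqrt 3)) / 2"
  define w' where "w' = (1 - \<i> * complex_of_real (sqrt 3)) / 2"
  define \<tau> where "\<tau> = - w"
  have \<tau>2: "\<tau> ^ 2 = - w'"
    by (simp add: \<tau>_def w_def w'_def complex_eq_iff power2_eq_square)
  have \<tau>3: "\<tau> ^ 3 = 1"
    by (simp add: \<tau>_def w_def complex_eq_iff power3_eq_cube)
  have \<tau>mod: "\<tau> ^ k = \<tau> ^ (k mod 3)" for k
    by (metis \<tau>3 mult_div_mod_eq power_add power_mult power_one mult_1)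
  define m where "m = ord x"
  have xc: "x \<in> carrier G" and m3: "3 dvd m" using x by (auto simp: Gamma3_def m_def)
  have m: "m > 0" using ord_ge_1 [OF fin xc] by (simp add: m_def)
  have mge: "m \<ge> 3" using m3 m by (simp add: dvd_imp_le)
  have \<chi>pow: "\<chi> (x [^] k) = \<chi> x ^ k" for k :: nat
    by (induction k) (simp_all add: \<chi>1 \<chi>m xc)
  define y where "y = \<tau> * \<chi> x"
  have "y ^ m = 1"
  proof -
    have "\<chi> x ^ m = 1" using \<chi>pow [of m] xc \<chi>1 by (simp add: m_def)
    moreover have "\<tau> ^ m = 1" using \<tau>mod [of m] m3 by (simp add: mod_eq_0_iff_dvd [symmetric])
    ultimately show ?thesis by (simp add: y_def power_mult_distrib)
  qed
  then have Rint: "(\<Sum>k\<in>totatives m. y ^ k) \<in> \<int>" by (rule sum_powers_totatives_Ints)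
  \<comment> \<open>As \<open>3 dvd m\<close>, no totative of \<open>m\<close> is divisible by 3, so
    the two classes exhaust the totatives, and \<open>m - k\<close> exchanges them. The exponents of
    \<open>ang G x\<close> are those in \<open>K1\<close>.\<close>
  define K1 where "K1 = {k \<in> totatives m. k mod 3 = 1}"
  define K2 where "K2 = {k \<in> totatives m. k mod 3 = 2}"
  have lt: "k < m" if "k \<in> totatives m" for k
    using totatives_less [OF that] mge by simp
  have tot: "totatives m = K1 \<union> K2"
  proof -
    have "k mod 3 \<noteq> 0" if "k \<in> totatives m" for k
    proof
      assume "k mod 3 = 0"
      then have "3 dvd k" by auto
      with m3 that show False
        by (metis in_totatives_iff coprime_common_divisor_nat numeral_eq_one_iff semiring_norm(86))
    qed
    then have "k mod 3 = 1 \<or> k mod 3 = 2" if "k \<in> totatives m" for k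
      using that by (metis One_nat_def less_2_cases_iff less_antisym mod_less_divisor
        numeral_3_eq_3 numeral_2_eq_2 zero_less_Suc)
    then show ?thesis unfolding K1_def K2_def by blast
  qed
  have flip: "m - k \<in> totatives m" if "k \<in> totatives m" for k
    using that lt [OF that] gcd_diff2_nat [of k m]
    by (auto simp: in_totatives_iff coprime_iff_gcd_eq_1 less_imp_le)
  have mod_flip: "(m - k) mod 3 = (3 - k mod 3) mod 3" if "k < m" for k
  proof -
    have "((m - k) mod 3 + k mod 3) mod 3 = 0" using that m3 by (simp add: mod_add_eq)
    moreover have "(m - k) mod 3 \<in> {0, 1, 2}" "k mod 3 \<in> {0, 1, 2}" by auto
    ultimately show ?thesis by (auto dest: dvd_imp_le)
  qed
  have "(\<Sum>k\<in>K2. y ^ k) = (\<Sum>k\<in>K1. y ^ (m - k))"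
    by (rule sum.reindex_bij_witness [of _ "\<lambda>k. m - k" "\<lambda>k. m - k"])
       (auto simp: K1_def K2_def flip mod_flip lt less_imp_le)
  moreover have "(\<Sum>k\<in>totatives m. y ^ k) = (\<Sum>k\<in>K1. y ^ k) + (\<Sum>k\<in>K2. y ^ k)"
    unfolding tot by (rule sum.union_disjoint) (auto simp: K1_def K2_def)
  ultimately have Rsum: "(\<Sum>k\<in>totatives m. y ^ k) = (\<Sum>k\<in>K1. y ^ k + y ^ (m - k))"
    by (simp add: sum.distrib)
  have angK: "ang G x = (\<lambda>k. x [^] k) ` K1"
    unfolding ang_def K1_def
    using lt mge by (fastforce simp: m_def in_totatives_iff coprime_iff_gcd_eq_1 cong_def)
  have "K1 \<subseteq> {1..ord x}" by (auto simp: K1_def m_def in_totatives_iff)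
  then have inj: "inj_on (\<lambda>k. x [^] k) K1"
    using inj_on_subset [OF ord_inj' [OF xc]] by blast
  have "(\<Sum>s\<in>ang G x. w * \<chi> s + w' * \<chi> (inv s))
      = (\<Sum>k\<in>K1. w * \<chi> (x [^] k) + w' * \<chi> (inv (x [^] k)))"
    unfolding angK by (simp add: sum.reindex [OF inj])
  also have "\<dots> = (\<Sum>k\<in>K1. - (y ^ k + y ^ (m - k)))"
  \<comment> \<open>For \<open>k\<close> in \<open>K1\<close>, \<open>\<tau> ^ k = - w\<close> and
    \<open>\<tau> ^ (m - k) = \<tau> ^ 2 = - w'\<close>, while the inverse of \<open>x [^] k\<close>
    is \<open>x [^] (m - k)\<close>. Both weights are thus absorbed into powers of
    \<open>y\<close>.\<close>
  proof (intro sum.cong refl)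
    fix k assume k: "k \<in> K1"
    then have km: "k < m" and k1: "k mod 3 = 1" using lt by (auto simp: K1_def)
    have "x [^] (m - k) \<otimes> x [^] k = \<one>"
      using xc km by (simp add: nat_pow_mult m_def)
    then have "inv (x [^] k) = x [^] (m - k)" using xc by (simp add: inv_equality)
    moreover have "\<tau> ^ k = - w" using \<tau>mod [of k] k1 by (simp add: \<tau>_def)
    then have "y ^ k = - w * \<chi> x ^ k" by (simp add: y_def power_mult_distrib)
    moreover have "y ^ (m - k) = - w' * \<chi> x ^ (m - k)"
      using \<tau>mod [of "m - k"] mod_flip [OF km] k1 \<tau>2 by (simp add: y_def power_mult_distrib)
    ultimately show "w * \<chi> (x [^] k) + w' * \<chi> (inv (x [^] k)) = - (y ^ k + y ^ (m - k))"
      by (simp add: \<chi>pow)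
  qed
  also have "\<dots> = - (\<Sum>k\<in>totatives m. y ^ k)" by (simp only: Rsum sum_negf)
  finally show ?thesis using Rint by (simp add: w_def w'_def)
qed

section \<open>Eigenvalues of the Cayley graph\<close>

lemma Cay_eigenvalue_Ints:
  assumes fin: "finite (carrier G)" and skew: "skew_symmetric G S"
    and X: "finite X" "X \<subseteq> Gamma3 G" and S: "S = (\<Union>x\<in>X. ang G x)"
    and vs: "distinct vs" "set vs = carrier G"
    and ev: "eigenvalue (hermitian_adjacency (Cay G S) vs) c"
  shows "c \<in> \<int>"
proof -
  define w where "w = (1 + \<i> * complex_of_real (sqrt 3)) / 2"
  define w' where "w' = (1 - \<i> * complex_of_real (sqrt 3)) / 2"
  \<comment> \<open>The matrix entry at \<open>u\<close>, \<open>v\<close> depends only on the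
    difference of the vertices. By skew-symmetry at most one summand is nonzero on the group, so a
    plain sum reproduces the entries and the entry 1 never occurs.\<close>
  define \<phi> where "\<phi> g = (if g \<in> S then w else 0) + (if inv g \<in> S then w' else 0)" for g
  define n where "n = length vs"
  have Sc: "S \<subseteq> carrier G"
    unfolding S ang_def using X by (auto simp: Gamma3_def)
  have entry: "hermitian_entry (Cay G S) u v = \<phi> (v \<otimes> inv u)"
    if "u \<in> carrier G" "v \<in> carrier G" for u v
  proof -
    have "inv (v \<otimes> inv u) = u \<otimes> inv v" using that by (simp add: inv_mult_group)
    then show ?thesis
      using that skew
      by (auto simp: hermitian_entry_def Cay_def \<phi>_def w_def w'_def skew_symmetric_def)
  qed
  have bij: "bij_betw ((!) vs) {..<n} (carrier G)"
    using vs bij_betw_nth [of vs "{..<n}" "carrier G"] by (simp add: n_def)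
  obtain v where v: "v \<in> carrier_vec n" "v \<noteq> 0\<^sub>v n"
    and Av: "hermitian_adjacency (Cay G S) vs *\<^sub>v v = c \<cdot>\<^sub>v v"
    using ev by (auto simp: eigenvalue_def eigenvector_def hermitian_adjacency_def n_def)
  define f where "f g = v $ (the_inv_into {..<n} ((!) vs) g)" for g
  have f_nth: "f (vs ! i) = v $ i" if "i < n" for i
    using the_inv_into_f_f [OF bij_betw_imp_inj_on [OF bij]] that by (simp add: f_def)
  have nz: "\<exists>u\<in>carrier G. f u \<noteq> 0"
  proof -
    obtain i where "i < n" "v $ i \<noteq> 0" using v by (metis carrier_vecD eq_vecI index_zero_vec(1,2))
    then show ?thesis using f_nth vs by (metis n_def nth_mem)
  qed
  have eig: "(\<Sum>g\<in>carrier G. \<phi> g * f (g \<otimes> u)) = c * f u" if u: "u \<in> carrier G" for u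
  proof -
    obtain i where i: "i < n" "u = vs ! i" using u vs by (metis in_set_conv_nth n_def)
    have "(\<Sum>g\<in>carrier G. \<phi> g * f (g \<otimes> u)) = (\<Sum>v\<in>carrier G. \<phi> (v \<otimes> inv u) * f v)"
      by (rule sum.reindex_bij_witness [of _ "\<lambda>v. v \<otimes> inv u" "\<lambda>g. g \<otimes> u"])
         (use u in \<open>auto simp: m_assoc\<close>)
    also have "\<dots> = (\<Sum>v\<in>carrier G. hermitian_entry (Cay G S) u v * f v)"
      using u by (simp add: entry)
    also have "\<dots> = (\<Sum>j<n. hermitian_entry (Cay G S) u (vs ! j) * f (vs ! j))"
      by (rule sum.reindex_bij_betw [OF bij, symmetric])
    also have "\<dots> = (hermitian_adjacency (Cay G S) vs *\<^sub>v v) $ i"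
      using i v by (simp add: hermitian_adjacency_def n_def scalar_prod_def f_nth atLeast0LessThan)
    also have "\<dots> = c * f u" using i v by (simp add: Av f_nth)
    finally show ?thesis .
  qed
  obtain \<chi> where \<chi>: "\<chi> \<one> = 1"
      "\<And>a b. a \<in> carrier G \<Longrightarrow> b \<in> carrier G \<Longrightarrow> \<chi> (a \<otimes> b) = \<chi> a * \<chi> b"
    and c: "c = (\<Sum>g\<in>carrier G. \<phi> g * \<chi> g)"
    using convolution_eigenvalue_character [where \<phi> = \<phi> and c = c and f = f, OF fin nz eig] by metis
  \<comment> \<open>Inversion moves the second weight onto \<open>S\<close>, so that both terms can
    be summed over \<open>S\<close>.\<close>
  have "(\<Sum>g\<in>carrier G. (if inv g \<in> S then w' else 0) * \<chi> g)
      = (\<Sum>g\<in>carrier G. (if g \<in> S then w' else 0) * \<chi> (inv g))"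
    by (rule sum.reindex_bij_witness [of _ "\<lambda>g. inv g" "\<lambda>g. inv g"]) auto
  then have "c = (\<Sum>g\<in>carrier G. (if g \<in> S then w else 0) * \<chi> g
      + (if g \<in> S then w' else 0) * \<chi> (inv g))"
    unfolding c \<phi>_def distrib_right sum.distrib by simp
  also have "\<dots> = (\<Sum>g\<in>carrier G. if g \<in> S then w * \<chi> g + w' * \<chi> (inv g) else 0)"
    by (intro sum.cong) auto
  also have "\<dots> = (\<Sum>s\<in>S. w * \<chi> s + w' * \<chi> (inv s))"
    using Sc fin by (simp add: sum.If_cases Int_absorb1 flip: sum.inter_restrict)
  \<comment> \<open>The outer sum runs over the sets and not over \<open>X\<close>, since different
    generators may give the same set; distinct sets are disjoint by
    \<open>ang_absorb\<close>.\<close>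
  also have "\<dots> = (\<Sum>C\<in>ang G ` X. \<Sum>s\<in>C. w * \<chi> s + w' * \<chi> (inv s))"
    unfolding S
  proof (subst sum.Union_disjoint)
    show "\<forall>C\<in>ang G ` X. finite C"
      using finite_subset [OF Sc fin] by (auto simp: S intro: finite_subset)
    show "\<forall>C\<in>ang G ` X. \<forall>D\<in>ang G ` X. C \<noteq> D \<longrightarrow> C \<inter> D = {}"
    proof (intro ballI impI equals0I)
      fix C D s assume "C \<in> ang G ` X" "D \<in> ang G ` X" "C \<noteq> D" "s \<in> C \<inter> D"
      then show False using ang_absorb [OF fin] X(2) by blast
    qed
  qed simp
  also have "\<dots> \<in> \<int>"
  proof (rule Ints_sum)
    fix C assume "C \<in> ang G ` X"
    then obtain x where x: "x \<in> Gamma3 G" "C = ang G x" using X(2) by blast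
    show "(\<Sum>s\<in>C. w * \<chi> s + w' * \<chi> (inv s)) \<in> \<int>"
      unfolding w_def w'_def x(2) using fin x(1) \<chi> by (rule ang_character_sum_Ints)
  qed
  finally show ?thesis .
qed

end

theorem theorem3p5:
  fixes G :: "('a, 'm) monoid_scheme" and S :: "'a set"
  assumes "comm_group G" and "finite (carrier G)"
    and "S \<subseteq> carrier G" and "\<one>\<^bsub>G\<^esub> \<notin> S"
    and "S \<in> EE G"
  shows "HS_integral (Cay G S)"
proof -
  obtain X where "finite X" "X \<subseteq> Gamma3 G" "S = (\<Union>x\<in>X. ang G x)" "skew_symmetric G S"
  proof (cases "Gamma3 G = {}")
    \<comment> \<open>Here \<open>S\<close> is empty, which is the union over the empty family of
      generators.\<close>
    case True
    then show thesis using assms(5) that [of "{}"] by (simp add: EE_def skew_symmetric_def)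
  next
    case False
    then show thesis using assms(5) that by (auto simp: EE_def)
  qed
  then show ?thesis
    using comm_group.Cay_eigenvalue_Ints [OF assms(1,2)] assms(2)
    by (auto simp: HS_integral_def Cay_def)
qed

end
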